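(* Let $n\ge 1$ and let $\alpha,\beta,\gamma,\delta>0$ be real numbers such that $\max\{\alpha,\beta\}\le\min\{\gamma,\delta\}$. Let $T:\mathbb{Z}^{n}\times\mathbb{Z}^{n}\to\mathbb{Z}^{n}$ be translation equivariant and monotone in the sense of Knothe, and suppose that $f,g,h,k:\mathbb{Z}^{n}\to[0,\infty)$ satisfy $$f(x)^{\alpha}\,g(y)^{\beta}\le h\big(T(x,y)\big)^{\gamma}\,k\big(x+y-T(x,y)\big)^{\delta}\qquad\text{for all } x,y\in\mathbb{Z}^{n}.$$ Then $$\Big(\sum_{x\in\mathbb{Z}^{n}}f(x)\Big)^{\alpha}\Big(\sum_{x\in\mathbb{Z}^{n}}g(x)\Big)^{\beta}\le\Big(\sum_{x\in\mathbb{Z}^{n}}h(x)\Big)^{\gamma}\Big(\sum_{x\in\mathbb{Z}^{n}}k(x)\Big)^{\delta}.$$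
   Context: An operation $T:\mathbb{Z}^n\times\mathbb{Z}^n\to\mathbb{Z}^n$ is translation equivariant if $T(x+z,y+z)=T(x,y)+z$ for all $x,y,z\in\mathbb{Z}^n$. A total additive ordering on an abelian group $G\cong\mathbb{Z}^l$ is a binary relation $\preceq$ that is reflexive, antisymmetric and transitive, such that any two elements are comparable, and such that $x\preceq y$ implies $x+z\preceq y+z$ for all $x,y,z\in G$. $T$ is monotone in the sense of Knothe if there exists a decomposition of $\mathbb{Z}^n$ into a direct sum of groups $\mathbb{Z}^n=G_1\times\dots\times G_k$ such that, writing $T=(T_1,\dots,T_k)$ according to this decomposition, for each $i\in\{1,\dots,k\}$: (i) $T_i(x,y)\in G_i$ depends only on the first $i$ coordinates of its arguments $x,y\in G_1\times\dots\times G_k$, so $T_i$ can be regarded as a map $(G_1\times\dots\times G_i)\times(G_1\times\dots\times G_i)\to G_i$; (ii) there exists a total additive ordering $\preceq_i$ on $G_i$ such that for all $a,b\in G_1\times\dots\times G_{i-1}$ the map $T_i^{(a,b)}:G_i\times G_i\to G_i$, $T_i^{(a,b)}(x,y)=T_i\big((a,x),(b,y)\big)$, satisfies: for all $x_1,x_2,y_1,y_2\in G_i$, if $x_1\preceq_i x_2$ and $y_1\preceq_i y_2$ then $T_i^{(a,b)}(x_1,y_1)\preceq_i T_i^{(a,b)}(x_2,y_2)$. Sums of nonnegative functions take values in $[0,\infty]$, with the usual convention $0\cdot\infty=0$. *)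

theory Defs
  imports "HOL-Analysis.Analysis"
begin

definition translation_equivariant :: "('a::ab_group_add \<Rightarrow> 'a \<Rightarrow> 'a) \<Rightarrow> bool" where
  "translation_equivariant T \<longleftrightarrow> (\<forall>x y z. T (x + z) (y + z) = T x y + z)"

definition add_subgroup :: "'a::ab_group_add set \<Rightarrow> bool" where
  "add_subgroup H \<longleftrightarrow> 0 \<in> H \<and> (\<forall>x\<in>H. \<forall>y\<in>H. x + y \<in> H) \<and> (\<forall>x\<in>H. - x \<in> H)"

definition total_additive_ordering :: "'a::ab_group_add set \<Rightarrow> 'a rel \<Rightarrow> bool" where
  "total_additive_ordering H r \<longleftrightarrow>
     linear_order_on H r \<and> (\<forall>x\<in>H. \<forall>y\<in>H. \<forall>z\<in>H. (x, y) \<in> r \<longrightarrow> (x + z, y + z) \<in> r)"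

text \<open>The decomposition is an internal direct sum: the ambient group is the direct sum of its
  subgroups \<open>G 1, \<dots>, G k\<close>, and a tuple in \<open>G 1 \<times> \<dots> \<times> G i\<close> is
  identified with the sum of its entries.\<close>

definition direct_sum_decomposition :: "nat \<Rightarrow> (nat \<Rightarrow> 'a::ab_group_add set) \<Rightarrow> bool" where
  "direct_sum_decomposition k G \<longleftrightarrow>
     (\<forall>i\<in>{1..k}. add_subgroup (G i)) \<and>
     (\<forall>x. \<exists>!c. c \<in> (\<Pi>\<^sub>E i\<in>{1..k}. G i) \<and> x = (\<Sum>i\<in>{1..k}. c i))"

definition component :: "nat \<Rightarrow> (nat \<Rightarrow> 'a::ab_group_add set) \<Rightarrow> nat \<Rightarrow> 'a \<Rightarrow> 'a" where
  "component k G i x = (THE c. c \<in> (\<Pi>\<^sub>E j\<in>{1..k}. G j) \<and> x = (\<Sum>j\<in>{1..k}. c j)) i"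

text \<open>The map \<open>T\<^sub>i\<^sup>(\<^sup>a\<^sup>,\<^sup>b\<^sup>)\<close>, for tuples \<open>a\<close>, \<open>b\<close> in
  \<open>G 1 \<times> \<dots> \<times> G (i - 1)\<close>. The coordinates with index above \<open>i\<close> are set to zero;
  this choice is immaterial as soon as \<open>T\<^sub>i\<close> depends only on the first \<open>i\<close> coordinates.\<close>

definition knothe_section ::
  "nat \<Rightarrow> (nat \<Rightarrow> 'a::ab_group_add set) \<Rightarrow> ('a \<Rightarrow> 'a \<Rightarrow> 'a) \<Rightarrow> nat \<Rightarrow>
     (nat \<Rightarrow> 'a) \<Rightarrow> (nat \<Rightarrow> 'a) \<Rightarrow> 'a \<Rightarrow> 'a \<Rightarrow> 'a" where
  "knothe_section k G T i a b x y =
     component k G i (T ((\<Sum>j\<in>{1..<i}. a j) + x) ((\<Sum>j\<in>{1..<i}. b j) + y))"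

definition knothe_monotone :: "('a::ab_group_add \<Rightarrow> 'a \<Rightarrow> 'a) \<Rightarrow> bool" where
  "knothe_monotone T \<longleftrightarrow>
     (\<exists>k G. direct_sum_decomposition k G \<and>
       (\<forall>i\<in>{1..k}.
          (\<forall>x x' y y'.
             (\<forall>j\<in>{1..i}. component k G j x = component k G j x' \<and>
                          component k G j y = component k G j y') \<longrightarrow>
             component k G i (T x y) = component k G i (T x' y')) \<and>
          (\<exists>r. total_additive_ordering (G i) r \<and>
             (\<forall>a \<in> (\<Pi>\<^sub>E j\<in>{1..<i}. G j). \<forall>b \<in> (\<Pi>\<^sub>E j\<in>{1..<i}. G j).
                \<forall>x\<^sub>1\<in>G i. \<forall>x\<^sub>2\<in>G i. \<forall>y\<^sub>1\<in>G i. \<forall>y\<^sub>2\<in>G i.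
                  (x\<^sub>1, x\<^sub>2) \<in> r \<and> (y\<^sub>1, y\<^sub>2) \<in> r \<longrightarrow>
                  (knothe_section k G T i a b x\<^sub>1 y\<^sub>1,
                   knothe_section k G T i a b x\<^sub>2 y\<^sub>2) \<in> r))))"

text \<open>Real powers on \<open>[0, \<infinity>]\<close>; only meant for exponents \<open>p > 0\<close>, where \<open>\<infinity>\<close> to the
  power \<open>p\<close> is \<open>\<infinity>\<close>.\<close>

definition ennreal_powr :: "ennreal \<Rightarrow> real \<Rightarrow> ennreal" where
  "ennreal_powr s p = (if s = \<infinity> then \<infinity> else ennreal (enn2real s powr p))"

end

theory Submission
  imports Defs
begin

text \<open>Three reductions lead to a statement about a single totally ordered group and finite sums.

  Let \<open>\<mu> = max \<alpha> \<beta>\<close>. Replacing \<open>f, g, h, k\<close> by their powers with exponents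
  \<open>\<alpha> / \<mu>, \<beta> / \<mu> \<le> 1 \<le> \<gamma> / \<mu>, \<delta> / \<mu>\<close> makes the hypothesis one with all exponents
  equal to 1. As \<open>s \<mapsto> s\<^sup>p\<close> is subadditive for \<open>p \<le> 1\<close> and superadditive for \<open>p \<ge> 1\<close>,
  the conclusion with exponents 1 gives back the one with the original exponents
  (\<open>four_functions_knothe_powr\<close>). Infinite sums are suprema of finite ones.

  For exponents 1 the conclusion has the same shape as the hypothesis, so it can be proved by summing
  out one summand \<open>G i\<close> at a time, starting with the last. Once the coordinates below \<open>i\<close> of both
  arguments are fixed, those of \<open>T x y\<close> are fixed too, and \<open>T\<^sub>i\<close> becomes a translation
  equivariant, monotone map on the ordered group \<open>G i\<close> (\<open>fibre_step\<close>).

  On one ordered group, put \<open>S x y = x + y - T x y\<close> and let \<open>x\<^sub>0\<close>, \<open>y\<^sub>0\<close> be the least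
  points of the finite sets over which \<open>f\<close> and \<open>g\<close> are summed. Equivariance and monotonicity give two facts
  (\<open>monotone_equivariant_has_corners\<close>): when both arguments increase strictly, so do \<open>T\<close> and
  \<open>S\<close>; and when only one argument increases, say \<open>x\<close>, either \<open>T x y\<^sub>0\<close> leaves
  \<open>T x\<^sub>0 y\<^sub>0\<close> at the first step or \<open>S x y\<^sub>0\<close> leaves \<open>S x\<^sub>0 y\<^sub>0\<close> at the first step.
  Now follow the monotone transport of the normalised mass of \<open>f\<close> to that of \<open>g\<close>. Its first atom
  sits at \<open>(x\<^sub>0, y\<^sub>0)\<close> and has as mass the smaller of the proportions
  \<open>f x\<^sub>0 / \<Sum>f\<close> and \<open>g y\<^sub>0 / \<Sum>g\<close>. Remove that atom. The remaining parts of \<open>f\<close> and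
  \<open>g\<close> satisfy the hypothesis with \<open>h\<close> deleted at \<open>T x\<^sub>0 y\<^sub>0\<close> and \<open>k\<close> reduced at
  \<open>S x\<^sub>0 y\<^sub>0\<close> (or with the roles exchanged), so induction applies to them. The inequality at the
  atom and the inequality for the rest recombine by Cauchy-Schwarz (\<open>peel_step\<close>).\<close>

section \<open>Peeling off one atom of the transport\<close>

lemma cauchy_schwarz_two:
  fixes a b c d p s :: real
  assumes "0 \<le> a" "0 \<le> b" "0 \<le> c" "0 \<le> d" "0 \<le> p" "0 \<le> s"
    and "p\<^sup>2 \<le> a * b" "s\<^sup>2 \<le> c * d"
  shows "(p + s)\<^sup>2 \<le> (a + c) * (b + d)"
proof -
  have "(p * s)\<^sup>2 \<le> (a * d) * (c * b)"
    using mult_mono[OF assms(7,8)] assms by (simp add: power_mult_distrib mult_ac)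
  moreover have "4 * ((a * d) * (c * b)) \<le> (a * d + c * b)\<^sup>2"
    using sum_squares_bound[of "a * d" "c * b"] zero_le_power2[of "a * d - c * b"]
    by (simp add: power2_eq_square algebra_simps)
  ultimately have "(2 * (p * s))\<^sup>2 \<le> (a * d + c * b)\<^sup>2"
    by (simp add: power_mult_distrib)
  hence "2 * (p * s) \<le> a * d + c * b"
    using assms by (intro power2_le_imp_le[of "2 * (p * s)"]) auto
  thus ?thesis
    using assms(7,8) by (simp add: power2_eq_square algebra_simps)
qed

text \<open>This is all that the argument for one block uses of the order. The pair \<open>(x0, y0)\<close> plays the
  part of the two minima. Since \<open>A\<close> and \<open>B\<close> range over all finite subsets, the property survives
  the removal of points.\<close>

definition has_corners :: "'a set \<Rightarrow> 'b set \<Rightarrow> ('a \<Rightarrow> 'b \<Rightarrow> 'c) \<Rightarrow> ('a \<Rightarrow> 'b \<Rightarrow> 'd) \<Rightarrow> bool" where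
  "has_corners X Y T S \<longleftrightarrow>
     (\<forall>A B. finite A \<and> A \<noteq> {} \<and> A \<subseteq> X \<and> finite B \<and> B \<noteq> {} \<and> B \<subseteq> Y \<longrightarrow>
       (\<exists>x0\<in>A. \<exists>y0\<in>B.
          (\<forall>x\<in>A - {x0}. \<forall>y\<in>B - {y0}. T x y \<noteq> T x0 y0 \<and> S x y \<noteq> S x0 y0) \<and>
          ((\<forall>x\<in>A - {x0}. T x y0 \<noteq> T x0 y0) \<or> (\<forall>x\<in>A - {x0}. S x y0 \<noteq> S x0 y0)) \<and>
          ((\<forall>y\<in>B - {y0}. T x0 y \<noteq> T x0 y0) \<or> (\<forall>y\<in>B - {y0}. S x0 y \<noteq> S x0 y0))))"

lemma sum_fun_upd:
  fixes f :: "'a \<Rightarrow> real"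
  assumes "finite A" "a \<in> A"
  shows "sum (f(a := c)) A = sum f A - f a + c"
  using assms by (simp add: sum.remove[of A a])

text \<open>Let \<open>F\<close> and \<open>G\<close> be the sums of \<open>f\<close> and \<open>g\<close>, and let \<open>p = f x0 / F\<close> be at most
  \<open>g y0 / G\<close>. Removing the proportion \<open>p\<close> of both masses at \<open>(x0, y0)\<close> empties \<open>x0\<close> and
  multiplies the value of \<open>g\<close> at \<open>y0\<close> by some \<open>l\<close> in the unit interval. By \<open>away\<close> and
  \<open>row\<close>, the value \<open>T x0 y0\<close> no longer occurs, so \<open>h\<close> may be set to 0 there. The value \<open>S x0 y0\<close> can recur only
  together with \<open>y0\<close>, so \<open>k\<close> may be multiplied by \<open>l\<close> there. The masses removed from \<open>h\<close> and
  \<open>k\<close> have product at least \<open>p\<^sup>2 * F * G\<close>, the remaining ones at least \<open>(1 - p)\<^sup>2 * F * G\<close>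
  by \<open>IH\<close>, and Cauchy-Schwarz adds these up to \<open>F * G\<close>.\<close>

lemma peel_step:
  fixes f :: "'a \<Rightarrow> real" and g :: "'b \<Rightarrow> real" and h :: "'c \<Rightarrow> real" and k :: "'d \<Rightarrow> real"
  assumes fin: "finite A" "finite B" "finite C" "finite D"
    and x0: "x0 \<in> A" and y0: "y0 \<in> B"
    and maps: "\<And>x y. x \<in> A \<Longrightarrow> y \<in> B \<Longrightarrow> T x y \<in> C \<and> S x y \<in> D"
    and nonneg: "\<And>x. 0 \<le> f x" "\<And>y. 0 \<le> g y" "\<And>t. 0 \<le> h t" "\<And>s. 0 \<le> k s"
    and le: "\<And>x y. x \<in> A \<Longrightarrow> y \<in> B \<Longrightarrow> f x * g y \<le> h (T x y) * k (S x y)"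
    and pos: "0 < sum f A" "0 < sum g B"
    and first: "f x0 * sum g B \<le> g y0 * sum f A"
    and away: "\<And>x y. x \<in> A - {x0} \<Longrightarrow> y \<in> B - {y0} \<Longrightarrow> T x y \<noteq> T x0 y0 \<and> S x y \<noteq> S x0 y0"
    and row: "\<And>x. x \<in> A - {x0} \<Longrightarrow> T x y0 \<noteq> T x0 y0"
    and IH: "\<And>g' h' k'. (\<And>y. 0 \<le> g' y) \<Longrightarrow> (\<And>t. 0 \<le> h' t) \<Longrightarrow> (\<And>s. 0 \<le> k' s) \<Longrightarrow>
        (\<And>x y. x \<in> A - {x0} \<Longrightarrow> y \<in> B \<Longrightarrow> f x * g' y \<le> h' (T x y) * k' (S x y)) \<Longrightarrow>
        sum f (A - {x0}) * sum g' B \<le> sum h' C * sum k' D"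
  shows "sum f A * sum g B \<le> sum h C * sum k D"
proof -
  define F where "F = sum f A"
  define G where "G = sum g B"
  define p where "p = f x0 / F"
  \<comment> \<open>If \<open>g y0 = 0\<close>, then \<open>p = 0\<close>, and division by zero gives the right value \<open>l = 1\<close>.\<close>
  define l where "l = 1 - p * G / g y0"
  define t0 where "t0 = T x0 y0"
  define s0 where "s0 = S x0 y0"
  have FG: "0 < F" "0 < G" using pos by (auto simp: F_def G_def)
  have p0: "0 \<le> p" using FG nonneg by (simp add: p_def)
  have p1: "p \<le> 1"
    using FG member_le_sum[of x0 A f] x0 fin nonneg by (simp add: p_def F_def)
  have pf: "f x0 = p * F" using FG by (simp add: p_def)
  have pG: "p * G \<le> g y0"
    using first FG by (simp add: p_def field_simps flip: F_def G_def)
  have lg: "(1 - l) * g y0 = p * G"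
    using pG nonneg(2)[of y0] p0 FG mult_nonneg_nonneg[OF p0, of G]
    by (cases "g y0 = 0") (auto simp: l_def simp del: mult_nonneg_nonneg)
  have l1: "l \<le> 1" using p0 FG nonneg(2)[of y0] by (simp add: l_def)
  have l0: "0 \<le> l"
    using pG nonneg(2)[of y0] FG by (cases "g y0 = 0") (auto simp: l_def field_simps)
  have t0: "t0 \<in> C" and s0: "s0 \<in> D" using maps[OF x0 y0] by (auto simp: t0_def s0_def)
  let ?g = "g(y0 := l * g y0)" and ?h = "h(t0 := 0)" and ?k = "k(s0 := l * k s0)"
  have main: "sum f (A - {x0}) * sum ?g B \<le> sum ?h C * sum ?k D"
  proof (rule IH)
    fix x y assume x: "x \<in> A - {x0}" and y: "y \<in> B"
    have T: "T x y \<noteq> t0" using away[OF x] row[OF x] y by (cases "y = y0") (auto simp: t0_def)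
    have base: "f x * g y \<le> h (T x y) * k (S x y)" using le x y by auto
    show "f x * ?g y \<le> ?h (T x y) * ?k (S x y)"
    proof (cases "y = y0")
      case True
      have "f x * (l * g y) \<le> l * (h (T x y) * k (S x y))"
        using mult_left_mono[OF base l0] by (simp add: mult_ac)
      moreover have "l * (h (T x y) * k (S x y)) \<le> h (T x y) * k (S x y)"
        using l1 nonneg by (intro mult_left_le_one_le) (auto simp: l0)
      ultimately show ?thesis using T True by (auto simp: mult_ac)
    next
      case False
      hence "S x y \<noteq> s0" using away[OF x] y by (auto simp: s0_def)
      thus ?thesis using T False base by simp
    qed
  qed (use nonneg l0 in auto)
  have sf: "sum f (A - {x0}) = (1 - p) * F"
    using fin x0 pf by (simp add: sum_diff1 F_def algebra_simps)
  have sg: "sum ?g B = (1 - p) * G"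
    using sum_fun_upd[OF fin(2) y0, of g "l * g y0"] lg by (simp add: G_def algebra_simps)
  have sh: "sum ?h C = sum h C - h t0"
    using sum_fun_upd[OF fin(3) t0, of h 0] by simp
  have sk: "sum ?k D = sum k D - (1 - l) * k s0"
    using sum_fun_upd[OF fin(4) s0, of k "l * k s0"] by (simp add: algebra_simps)
  have nn: "0 \<le> sum ?h C" "0 \<le> sum ?k D" by (auto intro!: sum_nonneg simp: nonneg l0)
  define q where "q = sqrt (F * G)"
  have q: "0 \<le> q" "q\<^sup>2 = F * G" using FG by (auto simp: q_def)
  have "(1 - l) * (f x0 * g y0) \<le> (1 - l) * (h t0 * k s0)"
    using le[OF x0 y0] l1 by (intro mult_left_mono) (auto simp: t0_def s0_def)
  moreover have "(1 - l) * (f x0 * g y0) = (p * q)\<^sup>2"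
  proof -
    have "(1 - l) * (f x0 * g y0) = f x0 * ((1 - l) * g y0)" by (simp add: mult_ac)
    also have "\<dots> = p\<^sup>2 * (F * G)" unfolding lg by (simp add: pf power2_eq_square)
    finally show ?thesis by (simp add: power_mult_distrib q(2))
  qed
  ultimately have one: "(p * q)\<^sup>2 \<le> h t0 * ((1 - l) * k s0)" by (simp add: mult_ac)
  have two: "((1 - p) * q)\<^sup>2 \<le> sum ?h C * sum ?k D"
    using main unfolding sf sg power_mult_distrib q(2) by (simp add: power2_eq_square mult_ac)
  have "(p * q + (1 - p) * q)\<^sup>2 \<le> (h t0 + sum ?h C) * ((1 - l) * k s0 + sum ?k D)"
    by (rule cauchy_schwarz_two) (use one two nn p0 p1 l1 q nonneg in auto)
  moreover have "p * q + (1 - p) * q = q" by (simp add: algebra_simps)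
  ultimately show ?thesis unfolding sh sk q(2)[unfolded F_def G_def] by (simp add: q(2) F_def G_def)
qed

text \<open>Each step deletes a point from \<open>A\<close> or from \<open>B\<close>. Exchanging \<open>f\<close> with \<open>g\<close> and
  \<open>(T, h)\<close> with \<open>(S, k)\<close> brings the four possible situations at the corner into the form of
  \<open>peel_step\<close>.\<close>

lemma four_functions_corners:
  fixes f :: "'a \<Rightarrow> real" and g :: "'b \<Rightarrow> real" and h :: "'c \<Rightarrow> real" and k :: "'d \<Rightarrow> real"
  assumes "finite A" "finite B" "finite C" "finite D"
    and corners: "has_corners X Y T S" and "A \<subseteq> X" "B \<subseteq> Y"
    and "\<And>x y. x \<in> A \<Longrightarrow> y \<in> B \<Longrightarrow> T x y \<in> C \<and> S x y \<in> D"
    and "\<And>x. 0 \<le> f x" "\<And>y. 0 \<le> g y" "\<And>t. 0 \<le> h t" "\<And>s. 0 \<le> k s"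
    and "\<And>x y. x \<in> A \<Longrightarrow> y \<in> B \<Longrightarrow> f x * g y \<le> h (T x y) * k (S x y)"
  shows "sum f A * sum g B \<le> sum h C * sum k D"
  using assms
proof (induction "card A + card B" arbitrary: A B f g h k rule: less_induct)
  case less
  note fin = less.prems(1-4) and sub = less.prems(6,7) and maps = less.prems(8)
  note nonneg = less.prems(9-12) and le = less.prems(13)
  have "0 \<le> sum f A" "0 \<le> sum g B" by (simp_all add: sum_nonneg nonneg)
  moreover have "0 \<le> sum h C * sum k D" by (simp add: sum_nonneg nonneg)
  ultimately consider "sum f A * sum g B = 0" | "0 < sum f A" "0 < sum g B"
    by fastforce
  thus ?case
  proof cases
    case 1
    thus ?thesis using \<open>0 \<le> sum h C * sum k D\<close> by (simp only:)
  next
    case pos: 2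
    hence "A \<noteq> {}" "B \<noteq> {}" by auto
    then obtain x0 y0 where x0: "x0 \<in> A" and y0: "y0 \<in> B"
      and away: "\<forall>x\<in>A - {x0}. \<forall>y\<in>B - {y0}. T x y \<noteq> T x0 y0 \<and> S x y \<noteq> S x0 y0"
      and row: "(\<forall>x\<in>A - {x0}. T x y0 \<noteq> T x0 y0) \<or> (\<forall>x\<in>A - {x0}. S x y0 \<noteq> S x0 y0)"
      and col: "(\<forall>y\<in>B - {y0}. T x0 y \<noteq> T x0 y0) \<or> (\<forall>y\<in>B - {y0}. S x0 y \<noteq> S x0 y0)"
      using corners[unfolded has_corners_def, rule_format, of A B] fin(1,2) sub by blast
    have cardA: "card (A - {x0}) < card A" and cardB: "card (B - {y0}) < card B"
      using card_Diff1_less[OF fin(1) x0] card_Diff1_less[OF fin(2) y0] by auto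
    have IHA: "sum f (A - {x0}) * sum g' B \<le> sum h' C * sum k' D"
      if "\<And>y. 0 \<le> g' y" "\<And>t. 0 \<le> h' t" "\<And>s. 0 \<le> k' s"
        "\<And>x y. x \<in> A - {x0} \<Longrightarrow> y \<in> B \<Longrightarrow> f x * g' y \<le> h' (T x y) * k' (S x y)" for g' h' k'
      using that cardA fin sub maps nonneg corners by (intro less.hyps) auto
    have IHB: "sum f' A * sum g (B - {y0}) \<le> sum h' C * sum k' D"
      if "\<And>y. 0 \<le> f' y" "\<And>t. 0 \<le> h' t" "\<And>s. 0 \<le> k' s"
        "\<And>x y. x \<in> A \<Longrightarrow> y \<in> B - {y0} \<Longrightarrow> f' x * g y \<le> h' (T x y) * k' (S x y)" for f' h' k'
      using that cardB fin sub maps nonneg corners by (intro less.hyps) auto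
    show ?thesis
    proof (cases "f x0 * sum g B \<le> g y0 * sum f A")
      case first: True
      from row show ?thesis
      proof
        assume row: "\<forall>x\<in>A - {x0}. T x y0 \<noteq> T x0 y0"
        show ?thesis
          by (rule peel_step[where T = T and S = S, OF fin x0 y0])
            (use maps nonneg le pos first away row IHA in auto)
      next
        assume row: "\<forall>x\<in>A - {x0}. S x y0 \<noteq> S x0 y0"
        have "sum f A * sum g B \<le> sum k D * sum h C"
        proof (rule peel_step[where T = S and S = T, OF fin(1,2,4,3) x0 y0])
          fix g' h' k'
          assume "\<And>y. 0 \<le> g' y" "\<And>t. 0 \<le> h' t" "\<And>s. 0 \<le> k' s"
            "\<And>x y. x \<in> A - {x0} \<Longrightarrow> y \<in> B \<Longrightarrow> f x * g' y \<le> h' (S x y) * k' (T x y)"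
          thus "sum f (A - {x0}) * sum g' B \<le> sum h' D * sum k' C"
            using IHA[of g' k' h'] by (simp add: mult.commute)
        next
          fix x y assume "x \<in> A" "y \<in> B"
          thus "f x * g y \<le> k (S x y) * h (T x y)" using le by (simp add: mult.commute)
        qed (use maps nonneg le pos first away row in auto)
        thus ?thesis by (simp add: mult.commute)
      qed
    next
      case False
      hence first: "g y0 * sum f A \<le> f x0 * sum g B" by simp
      from col show ?thesis
      proof
        assume col: "\<forall>y\<in>B - {y0}. T x0 y \<noteq> T x0 y0"
        have "sum g B * sum f A \<le> sum h C * sum k D"
        proof (rule peel_step[where T = "\<lambda>y x. T x y" and S = "\<lambda>y x. S x y", OF fin(2,1,3,4) y0 x0])
          fix f' h' k'
          assume "\<And>y. 0 \<le> f' y" "\<And>t. 0 \<le> h' t" "\<And>s. 0 \<le> k' s"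
            "\<And>y x. y \<in> B - {y0} \<Longrightarrow> x \<in> A \<Longrightarrow> g y * f' x \<le> h' (T x y) * k' (S x y)"
          thus "sum g (B - {y0}) * sum f' A \<le> sum h' C * sum k' D"
            using IHB[of f' h' k'] by (simp add: mult.commute)
        next
          fix y x assume "y \<in> B" "x \<in> A"
          thus "g y * f x \<le> h (T x y) * k (S x y)" using le by (simp add: mult.commute)
        qed (use maps nonneg le pos first away col in auto)
        thus ?thesis by (simp add: mult.commute)
      next
        assume col: "\<forall>y\<in>B - {y0}. S x0 y \<noteq> S x0 y0"
        have "sum g B * sum f A \<le> sum k D * sum h C"
        proof (rule peel_step[where T = "\<lambda>y x. S x y" and S = "\<lambda>y x. T x y", OF fin(2,1,4,3) y0 x0])
          fix f' h' k'
          assume "\<And>y. 0 \<le> f' y" "\<And>t. 0 \<le> h' t" "\<And>s. 0 \<le> k' s"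
            "\<And>y x. y \<in> B - {y0} \<Longrightarrow> x \<in> A \<Longrightarrow> g y * f' x \<le> h' (S x y) * k' (T x y)"
          thus "sum g (B - {y0}) * sum f' A \<le> sum h' D * sum k' C"
            using IHB[of f' k' h'] by (simp add: mult.commute)
        next
          fix y x assume "y \<in> B" "x \<in> A"
          thus "g y * f x \<le> k (S x y) * h (T x y)" using le by (simp add: mult.commute)
        qed (use maps nonneg le pos first away col in auto)
        thus ?thesis by (simp add: mult.commute)
      qed
    qed
  qed
qed

section \<open>Additive orderings\<close>

lemma finite_linear_order_least:
  assumes lin: "linear_order_on H r" and "finite A" "A \<noteq> {}" "A \<subseteq> H"
  shows "\<exists>a\<in>A. \<forall>x\<in>A. (a, x) \<in> r"
  using assms(2-)
proof (induction A rule: finite_ne_induct)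
  case (singleton x)
  thus ?case using lin by (auto simp: order_on_defs refl_on_def)
next
  case (insert x F)
  then obtain a where a: "a \<in> F" "\<forall>y\<in>F. (a, y) \<in> r" by auto
  have xH: "x \<in> H" and aH: "a \<in> H" using insert a by auto
  have xx: "(x, x) \<in> r" using lin xH by (auto simp: order_on_defs refl_on_def)
  show ?case
  proof (cases "(a, x) \<in> r")
    case True thus ?thesis using a by auto
  next
    case False
    hence "(x, a) \<in> r" using lin xH aH xx by (auto simp: order_on_defs total_on_def)
    moreover have "trans r" using lin by (auto simp: order_on_defs)
    ultimately show ?thesis using a xx by (auto dest: transD)
  qed
qed

text \<open>Comparing \<open>T\<close> at a point with \<open>T\<close> at a diagonal translate, which equivariance evaluates,
  shows that when the arguments grow by \<open>d\<close> and \<open>e\<close>, the value of \<open>T\<close> grows at least by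
  the smaller and at most by the larger increment. If both increments are positive, then \<open>T\<close> grows,
  and it grows by less than \<open>d + e\<close>, so \<open>S\<close> grows too. If one increment is 0, then \<open>T\<close> grows
  by some amount between 0 and the other increment. A function with this property cannot both stay
  constant from \<open>a\<close> to some \<open>u > a\<close> and grow at full speed from \<open>a\<close> to some \<open>v > a\<close>, because
  one of \<open>u\<close> and \<open>v\<close> comes first (fact \<open>stall\<close> below).\<close>

lemma monotone_equivariant_has_corners:
  fixes T :: "'a::ab_group_add \<Rightarrow> 'a \<Rightarrow> 'a"
  assumes sg: "add_subgroup H" and ord: "total_additive_ordering H r"
    and closed: "\<And>x y. x \<in> H \<Longrightarrow> y \<in> H \<Longrightarrow> T x y \<in> H"
    and equi: "\<And>x y z. x \<in> H \<Longrightarrow> y \<in> H \<Longrightarrow> z \<in> H \<Longrightarrow> T (x + z) (y + z) = T x y + z"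
    and mono: "\<And>x x' y y'. x \<in> H \<Longrightarrow> x' \<in> H \<Longrightarrow> y \<in> H \<Longrightarrow> y' \<in> H \<Longrightarrow>
        (x, x') \<in> r \<Longrightarrow> (y, y') \<in> r \<Longrightarrow> (T x y, T x' y') \<in> r"
  shows "has_corners H H T (\<lambda>x y. x + y - T x y)"
proof -
  have lin: "linear_order_on H r" and add: "\<And>x y z. x \<in> H \<Longrightarrow> y \<in> H \<Longrightarrow> z \<in> H \<Longrightarrow>
      (x, y) \<in> r \<Longrightarrow> (x + z, y + z) \<in> r"
    using ord by (auto simp: total_additive_ordering_def)
  have refl: "\<And>x. x \<in> H \<Longrightarrow> (x, x) \<in> r"
    and antisym: "\<And>x y. (x, y) \<in> r \<Longrightarrow> (y, x) \<in> r \<Longrightarrow> x = y"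
    and trans: "\<And>x y z. (x, y) \<in> r \<Longrightarrow> (y, z) \<in> r \<Longrightarrow> (x, z) \<in> r"
    and total: "\<And>x y. x \<in> H \<Longrightarrow> y \<in> H \<Longrightarrow> (x, y) \<in> r \<or> (y, x) \<in> r"
    using lin unfolding order_on_defs refl_on_def total_on_def
    by (blast, blast dest: antisymD, blast dest: transD, metis)
  have plus: "\<And>x y. x \<in> H \<Longrightarrow> y \<in> H \<Longrightarrow> x + y \<in> H" and zero: "0 \<in> H"
    and neg: "\<And>x. x \<in> H \<Longrightarrow> - x \<in> H"
    using sg by (auto simp: add_subgroup_def)
  have minus: "x - y \<in> H" if "x \<in> H" "y \<in> H" for x y
    using plus[OF that(1) neg[OF that(2)]] by simp
  have shift: "(a, b) \<in> r" if "(c, d) \<in> r" "c \<in> H" "d \<in> H" "a \<in> H" "a - c = b - d" for a b c d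
  proof -
    have "b = d + (a - c)" unfolding that(5) by simp
    thus ?thesis using add[OF that(2,3) minus[OF that(4,2)] that(1)] by simp
  qed
  have upper: "(T x' y', T x y + e) \<in> r"
    if "x \<in> H" "y \<in> H" "x' \<in> H" "y' \<in> H" "e \<in> H" "(x', x + e) \<in> r" "(y', y + e) \<in> r" for x y x' y' e
    using mono[OF that(3) plus[OF that(1,5)] that(4) plus[OF that(2,5)] that(6,7)] equi that by simp
  have lower: "(T x y + e, T x' y') \<in> r"
    if "x \<in> H" "y \<in> H" "x' \<in> H" "y' \<in> H" "e \<in> H" "(x + e, x') \<in> r" "(y + e, y') \<in> r" for x y x' y' e
    using mono[OF plus[OF that(1,5)] that(3) plus[OF that(2,5)] that(4) that(6,7)] equi that by simp
  have mono_left: "(T u y, T v y) \<in> r \<and> (T v y, T u y + (v - u)) \<in> r"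
    if "u \<in> H" "v \<in> H" "y \<in> H" "(u, v) \<in> r" for u v y
    using mono[OF that(1,2,3,3,4) refl[OF that(3)]]
      upper[OF that(1,3,2,3) minus[OF that(2,1)]] refl[OF that(2)]
      shift[OF that(4), of y "y + (v - u)"] plus minus that by (simp add: algebra_simps)
  have mono_right: "(T x u, T x v) \<in> r \<and> (T x v, T x u + (v - u)) \<in> r"
    if "u \<in> H" "v \<in> H" "x \<in> H" "(u, v) \<in> r" for u v x
    using mono[OF that(3,3,1,2) refl[OF that(3)] that(4)]
      upper[OF that(3,1,3,2) minus[OF that(2,1)]] refl[OF that(2)]
      shift[OF that(4), of x "x + (v - u)"] plus minus that by (simp add: algebra_simps)
  have stall: False
    if \<phi>H: "\<And>u. u \<in> H \<Longrightarrow> \<phi> u \<in> H"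
      and \<phi>: "\<And>u v. u \<in> H \<Longrightarrow> v \<in> H \<Longrightarrow> (u, v) \<in> r \<Longrightarrow> (\<phi> u, \<phi> v) \<in> r \<and> (\<phi> v, \<phi> u + (v - u)) \<in> r"
      and H: "a \<in> H" "u \<in> H" "v \<in> H"
      and u: "(a, u) \<in> r" "u \<noteq> a" "\<phi> u = \<phi> a"
      and v: "(a, v) \<in> r" "v \<noteq> a" "\<phi> v = \<phi> a + (v - a)" for \<phi> a u v
    using total[OF H(2,3)]
  proof
    assume "(u, v) \<in> r"
    hence "(\<phi> a + (v - a), \<phi> a + (v - u)) \<in> r" using \<phi>[of u v] H u(3) v(3) by simp
    hence "(u, a) \<in> r" by (rule shift) (use H \<phi>H plus minus in auto)
    thus False using u antisym by blast
  next
    assume "(v, u) \<in> r"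
    hence "(\<phi> a + (v - a), \<phi> a) \<in> r" using \<phi>[of v u] H u(3) v(3) by simp
    hence "(v, a) \<in> r" by (rule shift) (use H \<phi>H plus minus in auto)
    thus False using v antisym by blast
  qed
  show ?thesis
    unfolding has_corners_def
  proof (intro allI impI, elim conjE)
    fix A B assume A: "finite A" "A \<noteq> {}" "A \<subseteq> H" and B: "finite B" "B \<noteq> {}" "B \<subseteq> H"
    obtain x0 where x0: "x0 \<in> A" "\<And>x. x \<in> A \<Longrightarrow> (x0, x) \<in> r"
      using finite_linear_order_least[OF lin A] by auto
    obtain y0 where y0: "y0 \<in> B" "\<And>y. y \<in> B \<Longrightarrow> (y0, y) \<in> r"
      using finite_linear_order_least[OF lin B] by auto
    have xH: "x0 \<in> H" and yH: "y0 \<in> H" using A B x0 y0 by auto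
    \<comment> \<open>The two minima form the corner.\<close>
    have both: "T x y \<noteq> T x0 y0 \<and> x + y - T x y \<noteq> x0 + y0 - T x0 y0"
      if x: "x \<in> A" "x \<noteq> x0" and y: "y \<in> B" "y \<noteq> y0" for x y
    proof -
      have H: "x \<in> H" "y \<in> H" using A B x y by auto
      define d where "d = x - x0"
      define e where "e = y - y0"
      have de: "x = x0 + d" "y = y0 + e" "d \<in> H" "e \<in> H" "d \<noteq> 0" "e \<noteq> 0"
        using x y H xH yH minus by (auto simp: d_def e_def)
      have d0: "(0, d) \<in> r" using shift[OF x0(2)[OF x(1)], of 0 d] xH H zero by (simp add: d_def)
      have e0: "(0, e) \<in> r" using shift[OF y0(2)[OF y(1)], of 0 e] yH H zero by (simp add: e_def)
      define T0 where "T0 = T x0 y0"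
      have T0: "T0 \<in> H" using closed xH yH by (simp add: T0_def)
      have pos: "c = 0" if "(T0 + c, T0) \<in> r" "(0, c) \<in> r" "c \<in> H" for c
        using shift[OF that(1), of c 0] T0 plus that antisym by auto
      have "(d, e) \<in> r \<or> (e, d) \<in> r" using total de by auto
      thus ?thesis
      proof
        assume le: "(d, e) \<in> r"
        have l: "(T0 + d, T x y) \<in> r" unfolding T0_def
          using lower[OF xH yH H de(3)] shift[OF le, of "y0 + d" y] refl[OF H(1)] de yH plus by simp
        have u: "(T x y, T0 + e) \<in> r" unfolding T0_def
          using upper[OF xH yH H de(4)] shift[OF le, of x "x0 + e"] refl[OF H(2)] de H by simp
        have "T x y \<noteq> T0" using l pos[OF _ d0 de(3)] de by auto
        moreover have "T x y \<noteq> T0 + d + e"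
        proof
          assume "T x y = T0 + d + e"
          hence "(T0 + d, T0) \<in> r" using shift[OF u, of "T0 + d" T0] closed H T0 plus de by auto
          thus False using pos d0 de by auto
        qed
        ultimately show ?thesis using de by (auto simp: T0_def algebra_simps)
      next
        assume le: "(e, d) \<in> r"
        have l: "(T0 + e, T x y) \<in> r" unfolding T0_def
          using lower[OF xH yH H de(4)] shift[OF le, of "x0 + e" x] refl[OF H(2)] de xH plus by simp
        have u: "(T x y, T0 + d) \<in> r" unfolding T0_def
          using upper[OF xH yH H de(3)] shift[OF le, of y "y0 + d"] refl[OF H(1)] de H by simp
        have "T x y \<noteq> T0" using l pos[OF _ e0 de(4)] de by auto
        moreover have "T x y \<noteq> T0 + d + e"
        proof
          assume "T x y = T0 + d + e"
          hence "(T0 + e, T0) \<in> r" using shift[OF u, of "T0 + e" T0] closed H T0 plus de by auto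
          thus False using pos e0 de by auto
        qed
        ultimately show ?thesis using de by (auto simp: T0_def algebra_simps)
      qed
    qed
    have rowT: "T u y0 = T x0 y0 \<Longrightarrow> v + y0 - T v y0 = x0 + y0 - T x0 y0 \<Longrightarrow> False"
      if "u \<in> A" "u \<noteq> x0" "v \<in> A" "v \<noteq> x0" for u v
      using stall[of "\<lambda>x. T x y0" x0 u v] mono_left that A x0 yH closed
      by (auto simp: algebra_simps subset_iff)
    have colT: "T x0 u = T x0 y0 \<Longrightarrow> x0 + v - T x0 v = x0 + y0 - T x0 y0 \<Longrightarrow> False"
      if "u \<in> B" "u \<noteq> y0" "v \<in> B" "v \<noteq> y0" for u v
      using stall[of "\<lambda>y. T x0 y" y0 u v] mono_right that B y0 xH closed
      by (auto simp: algebra_simps subset_iff)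
    show "\<exists>x0\<in>A. \<exists>y0\<in>B.
        (\<forall>x\<in>A - {x0}. \<forall>y\<in>B - {y0}. T x y \<noteq> T x0 y0 \<and> x + y - T x y \<noteq> x0 + y0 - T x0 y0) \<and>
        ((\<forall>x\<in>A - {x0}. T x y0 \<noteq> T x0 y0) \<or> (\<forall>x\<in>A - {x0}. x + y0 - T x y0 \<noteq> x0 + y0 - T x0 y0)) \<and>
        ((\<forall>y\<in>B - {y0}. T x0 y \<noteq> T x0 y0) \<or> (\<forall>y\<in>B - {y0}. x0 + y - T x0 y \<noteq> x0 + y0 - T x0 y0))"
      by (rule bexI[OF _ x0(1)], rule bexI[OF _ y0(1)]) (use both rowT colT in blast)
  qed
qed

section \<open>Fibre sums along the decomposition\<close>

definition fibre_sum :: "(nat \<Rightarrow> 'a \<Rightarrow> 'b) \<Rightarrow> nat set \<Rightarrow> 'a set \<Rightarrow> ('a \<Rightarrow> real) \<Rightarrow> 'a \<Rightarrow> real" where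
  "fibre_sum \<pi> J E \<phi> x = (\<Sum>z\<in>{z \<in> E. \<forall>j\<in>J. \<pi> j z = \<pi> j x}. \<phi> z)"

text \<open>The part of the fibre over the coordinates \<open>1..<i\<close> of \<open>x\<close> on which coordinate \<open>i\<close> equals
  \<open>u\<close>, so that summing over \<open>u\<close> removes coordinate \<open>i\<close> from the fibre condition.\<close>

definition slice :: "(nat \<Rightarrow> 'a \<Rightarrow> 'b) \<Rightarrow> nat \<Rightarrow> 'a set \<Rightarrow> ('a \<Rightarrow> real) \<Rightarrow> 'a \<Rightarrow> 'b \<Rightarrow> real" where
  "slice \<pi> i E \<phi> x u = (\<Sum>z\<in>{z \<in> E. (\<forall>j\<in>{1..<i}. \<pi> j z = \<pi> j x) \<and> \<pi> i z = u}. \<phi> z)"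

lemma fibre_sum_eq_slice:
  assumes "1 \<le> i" "\<And>j. j \<in> {1..<i} \<Longrightarrow> \<pi> j w = \<pi> j x" "\<pi> i w = u"
  shows "fibre_sum \<pi> {1..i} E \<phi> w = slice \<pi> i E \<phi> x u"
proof -
  have "{1..i} = insert i {1..<i}" using assms(1) by auto
  thus ?thesis unfolding fibre_sum_def slice_def
    using assms(2,3) by (intro sum.cong) auto
qed

lemma fibre_sum_eq_sum_slices:
  assumes "finite E" "finite U" "\<pi> i ` E \<subseteq> U"
  shows "fibre_sum \<pi> {1..<i} E \<phi> x = (\<Sum>u\<in>U. slice \<pi> i E \<phi> x u)"
proof -
  let ?E = "{z \<in> E. \<forall>j\<in>{1..<i}. \<pi> j z = \<pi> j x}"
  have "(\<Sum>u\<in>U. sum \<phi> {z \<in> ?E. \<pi> i z = u}) = sum \<phi> ?E"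
    by (rule sum.group) (use assms in auto)
  thus ?thesis by (simp add: fibre_sum_def slice_def conj_assoc)
qed

context
  fixes m :: nat and G :: "nat \<Rightarrow> 'a::ab_group_add set"
  assumes dec: "direct_sum_decomposition m G"
begin

lemma subgroups: "j \<in> {1..m} \<Longrightarrow> add_subgroup (G j)"
  using dec by (simp add: direct_sum_decomposition_def)

lemma component_tuple:
  "(\<lambda>j. component m G j x) \<in> (\<Pi>\<^sub>E j\<in>{1..m}. G j) \<and> x = (\<Sum>j\<in>{1..m}. component m G j x)"
proof -
  have "\<exists>!c. c \<in> (\<Pi>\<^sub>E j\<in>{1..m}. G j) \<and> x = (\<Sum>j\<in>{1..m}. c j)"
    using dec by (simp add: direct_sum_decomposition_def)
  from theI'[OF this] show ?thesis unfolding component_def .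
qed

lemma component_mem: "j \<in> {1..m} \<Longrightarrow> component m G j x \<in> G j"
  using component_tuple[of x] by (auto simp: PiE_def)

lemma component_eqI:
  assumes c: "\<And>j. j \<in> {1..m} \<Longrightarrow> c j \<in> G j" and x: "x = (\<Sum>j\<in>{1..m}. c j)" and j: "j \<in> {1..m}"
  shows "component m G j x = c j"
proof -
  let ?c = "restrict c {1..m}"
  have "?c \<in> (\<Pi>\<^sub>E j\<in>{1..m}. G j) \<and> x = (\<Sum>j\<in>{1..m}. ?c j)"
    using c x by auto
  hence "(\<lambda>j. component m G j x) = ?c"
    using component_tuple[of x] dec unfolding direct_sum_decomposition_def by blast
  thus ?thesis using j by (metis restrict_apply')
qed

lemma component_ext:
  assumes "\<And>j. j \<in> {1..m} \<Longrightarrow> component m G j x = component m G j y"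
  shows "x = y"
  using component_tuple[of x] component_tuple[of y] assms by (metis (no_types, lifting) sum.cong)

lemma component_add:
  assumes "j \<in> {1..m}"
  shows "component m G j (x + y) = component m G j x + component m G j y"
proof (rule component_eqI[OF _ _ assms])
  show "component m G l x + component m G l y \<in> G l" if "l \<in> {1..m}" for l
    using subgroups[OF that] component_mem[OF that] by (auto simp: add_subgroup_def)
  show "x + y = (\<Sum>l\<in>{1..m}. component m G l x + component m G l y)"
    using component_tuple[of x] component_tuple[of y] by (simp add: sum.distrib)
qed

lemma component_diff:
  assumes "j \<in> {1..m}"
  shows "component m G j (x - y) = component m G j x - component m G j y"
  using component_add[OF assms, of "x - y" y] by (simp add: algebra_simps)

lemma component_prefix:
  assumes i: "i \<in> {1..m}" and j: "j \<in> {1..m}" and u: "u \<in> G i"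
    and a: "\<And>l. l \<in> {1..<i} \<Longrightarrow> a l \<in> G l"
  shows "component m G j ((\<Sum>l\<in>{1..<i}. a l) + u) = (if j < i then a j else if j = i then u else 0)"
proof (rule component_eqI[OF _ _ j])
  let ?c = "\<lambda>l. if l < i then a l else if l = i then u else 0"
  show "?c l \<in> G l" if "l \<in> {1..m}" for l
    using subgroups[OF that] a[of l] u that by (auto simp: add_subgroup_def)
  have "(\<Sum>l\<in>{1..m}. ?c l) = (\<Sum>l\<in>insert i {1..<i}. ?c l)"
    by (rule sum.mono_neutral_right) (use i in auto)
  thus "(\<Sum>l\<in>{1..<i}. a l) + u = (\<Sum>l\<in>{1..m}. ?c l)"
    by (simp add: add.commute)
qed

lemma fibre_sum_all_components:
  assumes "finite E"
  shows "fibre_sum (component m G) {1..m} E \<phi> x = (if x \<in> E then \<phi> x else 0)"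
proof -
  have "{z \<in> E. \<forall>j\<in>{1..m}. component m G j z = component m G j x} = E \<inter> {x}"
    using component_ext by blast
  thus ?thesis by (simp add: fibre_sum_def)
qed

text \<open>Summing out coordinate \<open>i\<close>. The fibre of \<open>x\<close> over the coordinates below \<open>i\<close> is cut into
  slices indexed by \<open>u\<close> in \<open>G i\<close>, and the hypothesis \<open>le\<close>, taken at the points with coordinates
  \<open>(a, u)\<close> and \<open>(b, v)\<close>, is the four functions hypothesis for the slices and the section of
  \<open>T\<^sub>i\<close> at \<open>a\<close>, \<open>b\<close>.\<close>

lemma fibre_step:
  fixes T :: "'a \<Rightarrow> 'a \<Rightarrow> 'a" and f g h k :: "'a \<Rightarrow> real"
  assumes i: "i \<in> {1..m}"
    and equi: "translation_equivariant T"
    and triang: "\<And>l x x' y y'. l \<in> {1..i} \<Longrightarrow>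
        (\<And>j. j \<in> {1..l} \<Longrightarrow> component m G j x = component m G j x' \<and>
                          component m G j y = component m G j y') \<Longrightarrow>
        component m G l (T x y) = component m G l (T x' y')"
    and ord: "total_additive_ordering (G i) r"
    and mono: "\<And>a b x x' y y'. a \<in> (\<Pi>\<^sub>E j\<in>{1..<i}. G j) \<Longrightarrow> b \<in> (\<Pi>\<^sub>E j\<in>{1..<i}. G j) \<Longrightarrow>
        x \<in> G i \<Longrightarrow> x' \<in> G i \<Longrightarrow> y \<in> G i \<Longrightarrow> y' \<in> G i \<Longrightarrow> (x, x') \<in> r \<Longrightarrow> (y, y') \<in> r \<Longrightarrow>
        (knothe_section m G T i a b x y, knothe_section m G T i a b x' y') \<in> r"
    and fin: "finite A" "finite B" "finite C" "finite D"
    and nonneg: "\<And>x. 0 \<le> f x" "\<And>x. 0 \<le> g x" "\<And>x. 0 \<le> h x" "\<And>x. 0 \<le> k x"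
    and le: "\<And>x y. fibre_sum (component m G) {1..i} A f x * fibre_sum (component m G) {1..i} B g y
        \<le> fibre_sum (component m G) {1..i} C h (T x y) * fibre_sum (component m G) {1..i} D k (x + y - T x y)"
  shows "fibre_sum (component m G) {1..<i} A f x * fibre_sum (component m G) {1..<i} B g y
        \<le> fibre_sum (component m G) {1..<i} C h (T x y) * fibre_sum (component m G) {1..<i} D k (x + y - T x y)"
proof -
  let ?c = "component m G"
  define a where "a = (\<lambda>j\<in>{1..<i}. ?c j x)"
  define b where "b = (\<lambda>j\<in>{1..<i}. ?c j y)"
  \<comment> \<open>\<open>p u\<close> has the coordinates of \<open>x\<close> below \<open>i\<close>, then \<open>u\<close>, then zeros; likewise \<open>q v\<close> for \<open>y\<close>.\<close>
  define p where "p u = (\<Sum>j\<in>{1..<i}. a j) + u" for u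
  define q where "q v = (\<Sum>j\<in>{1..<i}. b j) + v" for v
  define Ti where "Ti = knothe_section m G T i a b"
  define U where "U = ?c i ` A"
  define V where "V = ?c i ` B"
  \<comment> \<open>The values of the section need not be coordinates of points of \<open>C\<close> or \<open>D\<close>. They are added
      to the index sets, where they only contribute empty slices.\<close>
  define W where "W = ?c i ` C \<union> (\<lambda>(u, v). Ti u v) ` (U \<times> V)"
  define Z where "Z = ?c i ` D \<union> (\<lambda>(u, v). u + v - Ti u v) ` (U \<times> V)"
  have sub: "j \<in> {1..m}" if "j \<in> {1..<i}" for j using that i by auto
  have a: "a \<in> (\<Pi>\<^sub>E j\<in>{1..<i}. G j)" and b: "b \<in> (\<Pi>\<^sub>E j\<in>{1..<i}. G j)"
    using component_mem sub by (auto simp: a_def b_def)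
  have aG: "a l \<in> G l" and bG: "b l \<in> G l" if "l \<in> {1..<i}" for l
    using component_mem[OF sub[OF that]] that by (simp_all add: a_def b_def)
  have p: "?c i (p u) = u" "j \<in> {1..<i} \<Longrightarrow> ?c j (p u) = ?c j x" if "u \<in> G i" for u j
  proof -
    show "?c i (p u) = u"
      using component_prefix[OF i i that aG] by (simp add: p_def)
    show "?c j (p u) = ?c j x" if "j \<in> {1..<i}"
      using component_prefix[OF i sub[OF that] \<open>u \<in> G i\<close> aG] that by (simp add: p_def a_def)
  qed
  have q: "?c i (q u) = u" "j \<in> {1..<i} \<Longrightarrow> ?c j (q u) = ?c j y" if "u \<in> G i" for u j
  proof -
    show "?c i (q u) = u"
      using component_prefix[OF i i that bG] by (simp add: q_def)
    show "?c j (q u) = ?c j y" if "j \<in> {1..<i}"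
      using component_prefix[OF i sub[OF that] \<open>u \<in> G i\<close> bG] that by (simp add: q_def b_def)
  qed
  have Ti: "Ti u v = ?c i (T (p u) (q v))" for u v
    by (simp add: Ti_def knothe_section_def p_def q_def)
  have Tpq: "?c j (T (p u) (q v)) = ?c j (T x y)" if "j \<in> {1..<i}" "u \<in> G i" "v \<in> G i" for j u v
    by (rule triang) (use that p q in auto)
  have self: "?c i z = z" if "z \<in> G i" for z
    using component_prefix[OF i i that, of "\<lambda>_. 0"] sub subgroups by (auto simp: add_subgroup_def)
  have corners: "has_corners (G i) (G i) Ti (\<lambda>u v. u + v - Ti u v)"
  proof (rule monotone_equivariant_has_corners[OF subgroups[OF i] ord])
    show "Ti u v \<in> G i" for u v unfolding Ti by (rule component_mem[OF i])
    show "Ti (u + z) (v + z) = Ti u v + z" if "z \<in> G i" for u v z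
    proof -
      have "T (p (u + z)) (q (v + z)) = T (p u) (q v) + z"
        using equi by (simp add: p_def q_def translation_equivariant_def flip: add.assoc)
      thus ?thesis by (simp add: Ti component_add[OF i] self[OF that])
    qed
    show "(Ti u v, Ti u' v') \<in> r"
      if "u \<in> G i" "u' \<in> G i" "v \<in> G i" "v' \<in> G i" "(u, u') \<in> r" "(v, v') \<in> r" for u u' v v'
      using mono[OF a b that] by (simp add: Ti_def)
  qed
  have UV: "U \<subseteq> G i" "V \<subseteq> G i" using component_mem[OF i] by (auto simp: U_def V_def)
  have finU: "finite U" "finite V" "finite W" "finite Z" using fin by (auto simp: U_def V_def W_def Z_def)
  have nn: "0 \<le> slice ?c i E \<phi> w u" if "\<And>x. 0 \<le> \<phi> x" for E \<phi> w u
    unfolding slice_def by (rule sum_nonneg) (use that in auto)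
  have "sum (slice ?c i A f x) U * sum (slice ?c i B g y) V
      \<le> sum (slice ?c i C h (T x y)) W * sum (slice ?c i D k (x + y - T x y)) Z"
  proof (rule four_functions_corners[OF finU corners UV])
    fix u v assume "u \<in> U" "v \<in> V"
    hence uv: "u \<in> G i" "v \<in> G i" using UV by auto
    have "slice ?c i A f x u = fibre_sum ?c {1..i} A f (p u)"
      by (rule fibre_sum_eq_slice[symmetric]) (use p[OF uv(1)] i in auto)
    moreover have "slice ?c i B g y v = fibre_sum ?c {1..i} B g (q v)"
      by (rule fibre_sum_eq_slice[symmetric]) (use q[OF uv(2)] i in auto)
    moreover have "slice ?c i C h (T x y) (Ti u v) = fibre_sum ?c {1..i} C h (T (p u) (q v))"
      by (rule fibre_sum_eq_slice[symmetric]) (use Tpq uv i Ti in auto)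
    moreover have "slice ?c i D k (x + y - T x y) (u + v - Ti u v)
        = fibre_sum ?c {1..i} D k (p u + q v - T (p u) (q v))"
      by (rule fibre_sum_eq_slice[symmetric])
        (use Tpq uv i Ti p q sub in \<open>simp_all add: component_add component_diff\<close>)
    ultimately show "slice ?c i A f x u * slice ?c i B g y v
        \<le> slice ?c i C h (T x y) (Ti u v) * slice ?c i D k (x + y - T x y) (u + v - Ti u v)"
      using le by simp
  qed (auto simp: W_def Z_def intro!: nn nonneg)
  thus ?thesis
    using fibre_sum_eq_sum_slices[of A U ?c i f x] fibre_sum_eq_sum_slices[of B V ?c i g y]
      fibre_sum_eq_sum_slices[of C W ?c i h "T x y"] fibre_sum_eq_sum_slices[of D Z ?c i k "x + y - T x y"]
      fin finU by (simp add: U_def V_def W_def Z_def)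
qed

end

text \<open>With all coordinates prescribed, the fibre inequality is the hypothesis on \<open>f, g, h, k\<close>. With
  none prescribed it is the claim, so the induction runs downwards.\<close>

lemma four_functions_knothe:
  fixes T :: "'a::ab_group_add \<Rightarrow> 'a \<Rightarrow> 'a" and f g h k :: "'a \<Rightarrow> real"
  assumes equi: "translation_equivariant T" and knothe: "knothe_monotone T"
    and fin: "finite A" "finite B" "finite C" "finite D"
    and maps: "\<And>x y. x \<in> A \<Longrightarrow> y \<in> B \<Longrightarrow> T x y \<in> C \<and> x + y - T x y \<in> D"
    and nonneg: "\<And>x. 0 \<le> f x" "\<And>x. 0 \<le> g x" "\<And>x. 0 \<le> h x" "\<And>x. 0 \<le> k x"
    and le: "\<And>x y. f x * g y \<le> h (T x y) * k (x + y - T x y)"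
  shows "sum f A * sum g B \<le> sum h C * sum k D"
proof -
  obtain m G where dec: "direct_sum_decomposition m G"
    and all: "\<forall>i\<in>{1..m}.
          (\<forall>x x' y y'.
             (\<forall>j\<in>{1..i}. component m G j x = component m G j x' \<and>
                          component m G j y = component m G j y') \<longrightarrow>
             component m G i (T x y) = component m G i (T x' y')) \<and>
          (\<exists>r. total_additive_ordering (G i) r \<and>
             (\<forall>a \<in> (\<Pi>\<^sub>E j\<in>{1..<i}. G j). \<forall>b \<in> (\<Pi>\<^sub>E j\<in>{1..<i}. G j).
                \<forall>x\<^sub>1\<in>G i. \<forall>x\<^sub>2\<in>G i. \<forall>y\<^sub>1\<in>G i. \<forall>y\<^sub>2\<in>G i.
                  (x\<^sub>1, x\<^sub>2) \<in> r \<and> (y\<^sub>1, y\<^sub>2) \<in> r \<longrightarrow>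
                  (knothe_section m G T i a b x\<^sub>1 y\<^sub>1,
                   knothe_section m G T i a b x\<^sub>2 y\<^sub>2) \<in> r))"
    using knothe unfolding knothe_monotone_def by (elim exE conjE)
  have triang: "component m G i (T x y) = component m G i (T x' y')"
    if "i \<in> {1..m}" "\<And>j. j \<in> {1..i} \<Longrightarrow> component m G j x = component m G j x' \<and>
      component m G j y = component m G j y'" for i x x' y y'
    using bspec[OF all that(1), THEN conjunct1] that(2) by blast
  let ?F = "\<lambda>i. fibre_sum (component m G) {1..i}"
  have "\<forall>x y. ?F 0 A f x * ?F 0 B g y \<le> ?F 0 C h (T x y) * ?F 0 D k (x + y - T x y)"
  proof (rule inc_induct[of 0 m])
    show "\<forall>x y. ?F m A f x * ?F m B g y \<le> ?F m C h (T x y) * ?F m D k (x + y - T x y)"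
    proof (intro allI)
      fix x y
      note full = fibre_sum_all_components[OF dec fin(1)] fibre_sum_all_components[OF dec fin(2)]
        fibre_sum_all_components[OF dec fin(3)] fibre_sum_all_components[OF dec fin(4)]
      show "?F m A f x * ?F m B g y \<le> ?F m C h (T x y) * ?F m D k (x + y - T x y)"
      proof (cases "x \<in> A \<and> y \<in> B")
        case True
        thus ?thesis using le[of x y] maps[of x y] unfolding full by simp
      next
        case False
        hence "?F m A f x * ?F m B g y = 0" unfolding full by auto
        moreover have "0 \<le> ?F m C h (T x y) * ?F m D k (x + y - T x y)"
          unfolding full using nonneg by simp
        ultimately show ?thesis by linarith
      qed
    qed
  next
    fix i assume "0 \<le> i" "i < m"
      and IH: "\<forall>x y. ?F (Suc i) A f x * ?F (Suc i) B g y
          \<le> ?F (Suc i) C h (T x y) * ?F (Suc i) D k (x + y - T x y)"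
    have i: "Suc i \<in> {1..m}" using \<open>i < m\<close> by auto
    obtain r where r: "total_additive_ordering (G (Suc i)) r"
      and sections: "\<forall>a \<in> (\<Pi>\<^sub>E j\<in>{1..<Suc i}. G j). \<forall>b \<in> (\<Pi>\<^sub>E j\<in>{1..<Suc i}. G j).
                \<forall>x\<^sub>1\<in>G (Suc i). \<forall>x\<^sub>2\<in>G (Suc i). \<forall>y\<^sub>1\<in>G (Suc i). \<forall>y\<^sub>2\<in>G (Suc i).
                  (x\<^sub>1, x\<^sub>2) \<in> r \<and> (y\<^sub>1, y\<^sub>2) \<in> r \<longrightarrow>
                  (knothe_section m G T (Suc i) a b x\<^sub>1 y\<^sub>1,
                   knothe_section m G T (Suc i) a b x\<^sub>2 y\<^sub>2) \<in> r"
      using bspec[OF all i, THEN conjunct2] by (elim exE conjE)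
    have mono: "(knothe_section m G T (Suc i) a b x y, knothe_section m G T (Suc i) a b x' y') \<in> r"
      if "a \<in> (\<Pi>\<^sub>E j\<in>{1..<Suc i}. G j)" "b \<in> (\<Pi>\<^sub>E j\<in>{1..<Suc i}. G j)"
        "x \<in> G (Suc i)" "x' \<in> G (Suc i)" "y \<in> G (Suc i)" "y' \<in> G (Suc i)"
        "(x, x') \<in> r" "(y, y') \<in> r" for a b x x' y y'
      using sections[rule_format, OF that(1-6) conjI[OF that(7,8)]] .
    have "fibre_sum (component m G) {1..<Suc i} A f x * fibre_sum (component m G) {1..<Suc i} B g y
        \<le> fibre_sum (component m G) {1..<Suc i} C h (T x y)
          * fibre_sum (component m G) {1..<Suc i} D k (x + y - T x y)" for x y
    proof (rule fibre_step[OF dec i equi _ r mono fin nonneg])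
      show "component m G l (T x y) = component m G l (T x' y')"
        if "l \<in> {1..Suc i}" "\<And>j. j \<in> {1..l} \<Longrightarrow> component m G j x = component m G j x' \<and>
          component m G j y = component m G j y'" for l x x' y y'
        by (rule triang) (use that i in auto)
    qed (use IH in blast)+
    thus "\<forall>x y. ?F i A f x * ?F i B g y \<le> ?F i C h (T x y) * ?F i D k (x + y - T x y)"
      by (simp add: atLeastLessThanSuc_atLeastAtMost)
  qed simp
  thus ?thesis by (simp add: fibre_sum_def)
qed

section \<open>Exponents and infinite sums\<close>

text \<open>After normalising the sum to 1, each term lies in the unit interval, where \<open>t \<le> t\<^sup>p\<close>.\<close>

lemma powr_sum_le_sum_powr:
  fixes f :: "'a \<Rightarrow> real"
  assumes "finite A" "\<And>x. x \<in> A \<Longrightarrow> 0 \<le> f x" "0 < p" "p \<le> 1"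
  shows "sum f A powr p \<le> (\<Sum>x\<in>A. f x powr p)"
proof (cases "sum f A = 0")
  case True
  thus ?thesis by (simp add: sum_nonneg)
next
  case False
  define s where "s = sum f A"
  have s: "0 < s" using False assms(2) sum_nonneg[of A f] by (simp add: s_def)
  have "f x / s \<le> f x powr p / s powr p" if "x \<in> A" for x
  proof -
    have "0 \<le> f x / s" "f x / s \<le> 1"
      using assms(1,2) that s member_le_sum[of x A f] by (auto simp: s_def)
    hence "(f x / s) powr 1 \<le> (f x / s) powr p"
      using assms(4) by (intro powr_mono') auto
    thus ?thesis using s assms(2)[OF that] \<open>0 \<le> f x / s\<close> by (simp add: powr_divide)
  qed
  hence "(\<Sum>x\<in>A. f x / s) \<le> (\<Sum>x\<in>A. f x powr p / s powr p)" by (rule sum_mono)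
  moreover have "(\<Sum>x\<in>A. f x / s) = 1" using s by (simp add: s_def flip: sum_divide_distrib)
  ultimately show ?thesis using s by (simp add: field_simps flip: sum_divide_distrib s_def)
qed

lemma sum_powr_le_powr_sum:
  fixes f :: "'a \<Rightarrow> real"
  assumes "finite A" "\<And>x. x \<in> A \<Longrightarrow> 0 \<le> f x" "1 \<le> p"
  shows "(\<Sum>x\<in>A. f x powr p) \<le> sum f A powr p"
proof -
  have "(\<Sum>x\<in>A. f x powr p) powr (1 / p) \<le> (\<Sum>x\<in>A. (f x powr p) powr (1 / p))"
    using assms by (intro powr_sum_le_sum_powr) auto
  also have "\<dots> = sum f A" using assms by (intro sum.cong) (auto simp: powr_powr)
  finally have "((\<Sum>x\<in>A. f x powr p) powr (1 / p)) powr p \<le> sum f A powr p"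
    using assms by (intro powr_mono2) auto
  thus ?thesis using assms by (simp add: powr_powr sum_nonneg)
qed

lemma four_functions_knothe_powr:
  fixes T :: "'a::ab_group_add \<Rightarrow> 'a \<Rightarrow> 'a" and f g h k :: "'a \<Rightarrow> real" and \<alpha> \<beta> \<gamma> \<delta> :: real
  assumes expo: "\<alpha> > 0" "\<beta> > 0" "max \<alpha> \<beta> \<le> min \<gamma> \<delta>"
    and T: "translation_equivariant T" "knothe_monotone T"
    and fin: "finite A" "finite B" "finite C" "finite D"
    and maps: "\<And>x y. x \<in> A \<Longrightarrow> y \<in> B \<Longrightarrow> T x y \<in> C \<and> x + y - T x y \<in> D"
    and nonneg: "\<And>x. 0 \<le> f x" "\<And>x. 0 \<le> g x" "\<And>x. 0 \<le> h x" "\<And>x. 0 \<le> k x"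
    and le: "\<And>x y. f x powr \<alpha> * g y powr \<beta> \<le> h (T x y) powr \<gamma> * k (x + y - T x y) powr \<delta>"
  shows "sum f A powr \<alpha> * sum g B powr \<beta> \<le> sum h C powr \<gamma> * sum k D powr \<delta>"
proof -
  define \<mu> where "\<mu> = max \<alpha> \<beta>"
  have \<mu>: "0 < \<mu>" "\<alpha> \<le> \<mu>" "\<beta> \<le> \<mu>" "\<mu> \<le> \<gamma>" "\<mu> \<le> \<delta>" using expo by (auto simp: \<mu>_def)
  have root: "(s powr p * t powr q) powr (1 / \<mu>) = s powr (p / \<mu>) * t powr (q / \<mu>)" for s t p q :: real
    by (simp add: powr_mult powr_powr)
  have pow: "(s powr (p / \<mu>) * t powr (q / \<mu>)) powr \<mu> = s powr p * t powr q" for s t p q :: real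
    using \<mu> by (simp add: powr_mult powr_powr)
  have "sum f A powr (\<alpha> / \<mu>) * sum g B powr (\<beta> / \<mu>)
      \<le> (\<Sum>x\<in>A. f x powr (\<alpha> / \<mu>)) * (\<Sum>x\<in>B. g x powr (\<beta> / \<mu>))"
    using fin nonneg expo \<mu> by (intro mult_mono powr_sum_le_sum_powr) (auto simp: sum_nonneg)
  also have "\<dots> \<le> (\<Sum>x\<in>C. h x powr (\<gamma> / \<mu>)) * (\<Sum>x\<in>D. k x powr (\<delta> / \<mu>))"
  proof (rule four_functions_knothe[OF T fin maps])
    fix x y
    show "f x powr (\<alpha> / \<mu>) * g y powr (\<beta> / \<mu>) \<le> h (T x y) powr (\<gamma> / \<mu>) * k (x + y - T x y) powr (\<delta> / \<mu>)"
      using powr_mono2[OF _ _ le[of x y], of "1 / \<mu>"] \<mu> by (simp only: root) simp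
  qed auto
  also have "\<dots> \<le> sum h C powr (\<gamma> / \<mu>) * sum k D powr (\<delta> / \<mu>)"
    using fin nonneg \<mu> by (intro mult_mono sum_powr_le_powr_sum) (auto simp: sum_nonneg)
  finally have "(sum f A powr (\<alpha> / \<mu>) * sum g B powr (\<beta> / \<mu>)) powr \<mu>
      \<le> (sum h C powr (\<gamma> / \<mu>) * sum k D powr (\<delta> / \<mu>)) powr \<mu>"
    using \<mu> by (intro powr_mono2) auto
  thus ?thesis by (simp only: pow)
qed

lemma ennreal_powr_mono: "0 < p \<Longrightarrow> u \<le> v \<Longrightarrow> ennreal_powr u p \<le> ennreal_powr v p"
  by (cases u; cases v) (auto simp: ennreal_powr_def powr_mono2 top_unique)

lemma ennreal_powr_inverse: "0 < p \<Longrightarrow> ennreal_powr (ennreal_powr u (1 / p)) p = u"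
  by (cases u) (auto simp: ennreal_powr_def powr_powr)

text \<open>An increasing bijection of \<open>[0, \<infinity>]\<close> commutes with suprema. Its inverse is the power with
  exponent \<open>1 / p\<close>.\<close>

lemma ennreal_powr_infsum:
  fixes f :: "'a \<Rightarrow> real"
  assumes "0 < p" "\<And>x. 0 \<le> f x"
  shows "ennreal_powr (\<Sum>\<^sub>\<infinity>x. ennreal (f x)) p = (SUP A\<in>Collect finite. ennreal (sum f A powr p))"
proof -
  have fin: "ennreal_powr (\<Sum>x\<in>A. ennreal (f x)) p = ennreal (sum f A powr p)" for A
    using assms by (simp add: ennreal_powr_def sum_nonneg)
  have s: "(\<Sum>\<^sub>\<infinity>x. ennreal (f x)) = (SUP A\<in>Collect finite. \<Sum>x\<in>A. ennreal (f x))"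
    by (simp add: nonneg_infsum_complete)
  show ?thesis
  proof (rule antisym)
    show "(SUP A\<in>Collect finite. ennreal (sum f A powr p)) \<le> ennreal_powr (\<Sum>\<^sub>\<infinity>x. ennreal (f x)) p"
      unfolding s
    proof (rule SUP_least)
      fix A :: "'a set" assume "A \<in> Collect finite"
      thus "ennreal (sum f A powr p) \<le> ennreal_powr (SUP A\<in>Collect finite. \<Sum>x\<in>A. ennreal (f x)) p"
        unfolding fin[symmetric] by (intro ennreal_powr_mono assms SUP_upper)
    qed
    let ?R = "SUP A\<in>Collect finite. ennreal (sum f A powr p)"
    have "(\<Sum>\<^sub>\<infinity>x. ennreal (f x)) \<le> ennreal_powr ?R (1 / p)"
      unfolding s
    proof (rule SUP_least)
      fix A :: "'a set" assume "A \<in> Collect finite"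
      hence "ennreal_powr (\<Sum>x\<in>A. ennreal (f x)) p \<le> ?R" unfolding fin by (rule SUP_upper)
      hence "ennreal_powr (ennreal_powr (\<Sum>x\<in>A. ennreal (f x)) p) (1 / p) \<le> ennreal_powr ?R (1 / p)"
        using assms by (intro ennreal_powr_mono) auto
      thus "(\<Sum>x\<in>A. ennreal (f x)) \<le> ennreal_powr ?R (1 / p)"
        using ennreal_powr_inverse[of "1 / p"] assms by simp
    qed
    hence "ennreal_powr (\<Sum>\<^sub>\<infinity>x. ennreal (f x)) p \<le> ennreal_powr (ennreal_powr ?R (1 / p)) p"
      using assms by (intro ennreal_powr_mono) auto
    thus "ennreal_powr (\<Sum>\<^sub>\<infinity>x. ennreal (f x)) p \<le> ?R"
      by (simp add: ennreal_powr_inverse assms)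
  qed
qed

theorem theorem1p2:
  fixes T :: "int ^ 'n \<Rightarrow> int ^ 'n \<Rightarrow> int ^ 'n"
    and f g h k :: "int ^ 'n \<Rightarrow> real"
    and \<alpha> \<beta> \<gamma> \<delta> :: real
  assumes "\<alpha> > 0" and "\<beta> > 0" and "\<gamma> > 0" and "\<delta> > 0"
    and "max \<alpha> \<beta> \<le> min \<gamma> \<delta>"
    and "translation_equivariant T"
    and "knothe_monotone T"
    and "\<And>x. f x \<ge> 0" and "\<And>x. g x \<ge> 0" and "\<And>x. h x \<ge> 0" and "\<And>x. k x \<ge> 0"
    and "\<And>x y. f x powr \<alpha> * g y powr \<beta> \<le> h (T x y) powr \<gamma> * k (x + y - T x y) powr \<delta>"
  shows "ennreal_powr (\<Sum>\<^sub>\<infinity>x. ennreal (f x)) \<alpha> * ennreal_powr (\<Sum>\<^sub>\<infinity>x. ennreal (g x)) \<beta>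
         \<le> ennreal_powr (\<Sum>\<^sub>\<infinity>x. ennreal (h x)) \<gamma> * ennreal_powr (\<Sum>\<^sub>\<infinity>x. ennreal (k x)) \<delta>"
    (is "?F * ?G \<le> ?H * ?K")
proof -
  have finite_le: "ennreal (sum f A powr \<alpha>) * ennreal (sum g B powr \<beta>) \<le> ?H * ?K"
    if "finite A" "finite B" for A B
  proof -
    define C where "C = (\<lambda>(x, y). T x y) ` (A \<times> B)"
    define D where "D = (\<lambda>(x, y). x + y - T x y) ` (A \<times> B)"
    have fin: "finite C" "finite D" using that by (auto simp: C_def D_def)
    have "sum f A powr \<alpha> * sum g B powr \<beta> \<le> sum h C powr \<gamma> * sum k D powr \<delta>"
      by (rule four_functions_knothe_powr[where T = T])
        (use assms that fin in \<open>auto simp: C_def D_def\<close>)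
    hence "ennreal (sum f A powr \<alpha>) * ennreal (sum g B powr \<beta>)
        \<le> ennreal (sum h C powr \<gamma>) * ennreal (sum k D powr \<delta>)"
      by (simp add: ennreal_leI flip: ennreal_mult)
    also have "\<dots> \<le> ?H * ?K"
      unfolding ennreal_powr_infsum[OF assms(3,10)] ennreal_powr_infsum[OF assms(4,11)]
      using fin by (intro mult_mono SUP_upper) auto
    finally show ?thesis .
  qed
  have "?F * ?G = (SUP B\<in>Collect finite. SUP A\<in>Collect finite.
      ennreal (sum f A powr \<alpha>) * ennreal (sum g B powr \<beta>))"
    unfolding ennreal_powr_infsum[OF assms(1,8)] ennreal_powr_infsum[OF assms(2,9)]
    by (simp add: SUP_mult_right_ennreal SUP_mult_left_ennreal)
  also have "\<dots> \<le> ?H * ?K"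
    using finite_le by (intro SUP_least) auto
  finally show ?thesis .
qed

end
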